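(* For every $\mathcal{C}\ge1$ there is a constant $C'>0$ depending only on $\mathcal{C}$ such that the following holds. Let $f\colon\mathbb{R}^d\to\mathbb{R}$ be convex with a global minimizer $x^*$, $\|x^*\|\le\mathcal{R}$, $\mathcal{R}>0$, $f^*=f(x^* )$, and suppose that $f$ admits a stochastic gradient estimator satisfying the $(\mathcal{G}_0,\mathcal{G}_1)$ stochastic generalized Lipschitz condition, with $\mathcal{R}\mathcal{G}_1\ge1$. Let $x_k$ be generated by the averaged online scheme (see context) with $\alpha_k=1/k$, $\pi_0=0$, $\pi_k=k$, where the online iterates $z_k\in Q_{\mathcal{R}}$ satisfy the regret bound with constant $\mathcal{C}$. Let $\epsilon>0$ and $$K=\Big\lceil\Big[\frac{\mathcal{R}\mathcal{G}_0}{\epsilon}\Big]^2+[\mathcal{R}\mathcal{G}_1]^2\,\frac{\mathcal{F}}{\epsilon}\cdot\ln\Big[e+\frac{\mathcal{R}\mathcal{G}_0}{\epsilon}+[\mathcal{R}\mathcal{G}_1]^2\,\frac{\mathcal{F}}{\epsilon}\Big]\Big\rceil\in\mathbb{N}.$$ Then $\mathbb{E}[f(x_K)-f^*]\le C'\epsilon$.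
   Context: $\|\cdot\|$ is the Euclidean norm; $Q_{\mathcal{R}}=\{x:\|x\|\le\mathcal{R}\}$; $\mathcal{F}=\max_{x\in Q_{\mathcal{R}}}[f(x)-f^*]$; $\mathbb{N}$ is the set of positive integers; $\nabla f(x)\in\partial f(x)$ denotes a subgradient. $(\mathcal{G}_0,\mathcal{G}_1)$ stochastic generalized Lipschitz condition ($\mathcal{G}_0,\mathcal{G}_1\ge0$): there is an estimator $\nabla_\xi f(x)$, $\xi\sim\mathcal{D}$, with $\mathbb{E}_{\xi\sim\mathcal{D}}[\nabla_\xi f(x)]=\nabla f(x)$ for all $x$, and a decomposition $\nabla_\xi f(x)=u_\xi(x)+v_\xi(x)$ such that for all $x$: $\mathbb{E}_{\xi\sim\mathcal{D}}\|u_\xi(x)\|^2\le\mathcal{G}_0^2$ and $\|v_\xi(x)\|\le\mathcal{G}_1[f(x)-f^*]$ almost surely. Averaged online scheme: given $\alpha_k\in[0,1]$ and weights $\pi_k\ge0$ with $\pi_k(1-\alpha_k)=\pi_{k-1}$ for $k\in\mathbb{N}$, put $x_0=0$ and $x_k=(1-\alpha_k)x_{k-1}+\alpha_kz_k$ for $k\in\mathbb{N}$, where $z_k\in Q_{\mathcal{R}}$ is produced by an online algorithm receiving the linear losses $g_1,\dots,g_{k-1}$, with $g_k=\alpha_k\pi_k\nabla_{\xi_k}f(x_k)$ (the stochastic gradient at $z_k$ of $f_k(x)=\pi_kf(\alpha_kx+(1-\alpha_k)x_{k-1})$), and $\xi_k\sim\mathcal{D}$ are random samples with $\xi_k$ independent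 of $z_1,\dots,z_k$. The regret is $\mathrm{Reg}_K=\max_{z\in Q_{\mathcal{R}}}\sum_{k=1}^K\langle z_k-z,g_k\rangle$. Regret bound with constant $\mathcal{C}\ge1$: $\mathrm{Reg}_K\le\mathcal{C}\mathcal{R}\sqrt{\sum_{k=1}^K\|g_k\|^2}$ almost surely, for every $K\in\mathbb{N}$. *)

theory Defs
  imports "HOL-Probability.Probability"
begin

definition subdifferential :: "('v::real_inner \<Rightarrow> real) \<Rightarrow> 'v \<Rightarrow> 'v set" where
  "subdifferential f x = {h. \<forall>y. f y \<ge> f x + h \<bullet> (y - x)}"

(* est s x is the stochastic gradient with sample s at the point x, and grad is the selection
   of subgradients that it estimates.  Measurability is joint in (s, x), so that est (\<xi> \<omega>) (X \<omega>)
   is a random vector for a random sample \<xi> and a random point X.  The integrability clause is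
   needed because the Bochner integral of a non-integrable function is 0. *)
definition stoch_gen_lipschitz ::
  "'s measure \<Rightarrow> ('v::euclidean_space \<Rightarrow> real) \<Rightarrow> real \<Rightarrow> ('v \<Rightarrow> 'v) \<Rightarrow> ('s \<Rightarrow> 'v \<Rightarrow> 'v)
     \<Rightarrow> real \<Rightarrow> real \<Rightarrow> bool" where
  "stoch_gen_lipschitz D f fstar grad est G0 G1 \<longleftrightarrow>
     prob_space D \<and> 0 \<le> G0 \<and> 0 \<le> G1 \<and>
     (\<forall>x. grad x \<in> subdifferential f x) \<and>
     (\<lambda>(s, x). est s x) \<in> borel_measurable (D \<Otimes>\<^sub>M borel) \<and>
     (\<forall>x. has_bochner_integral D (\<lambda>s. est s x) (grad x)) \<and>
     (\<exists>u v. (\<lambda>(s, x). u s x) \<in> borel_measurable (D \<Otimes>\<^sub>M borel) \<and>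
            (\<lambda>(s, x). v s x) \<in> borel_measurable (D \<Otimes>\<^sub>M borel) \<and>
            (\<forall>s\<in>space D. \<forall>x. est s x = u s x + v s x) \<and>
            (\<forall>x. integrable D (\<lambda>s. (norm (u s x))\<^sup>2) \<and>
                 (\<integral>s. (norm (u s x))\<^sup>2 \<partial>D) \<le> G0\<^sup>2) \<and>
            (\<forall>x. AE s in D. norm (v s x) \<le> G1 * (f x - fstar)))"

fun avg_iter :: "(nat \<Rightarrow> real) \<Rightarrow> (nat \<Rightarrow> 'v::real_vector) \<Rightarrow> nat \<Rightarrow> 'v" where
  "avg_iter \<alpha> z 0 = 0"
| "avg_iter \<alpha> z (Suc k) =
     (1 - \<alpha> (Suc k)) *\<^sub>R avg_iter \<alpha> z k + \<alpha> (Suc k) *\<^sub>R z (Suc k)"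

(* The stochastic gradient at z k of y \<mapsto> \<pi> k * f (\<alpha> k *\<^sub>R y + (1 - \<alpha> k) *\<^sub>R x), where x is the
   averaged iterate with index k - 1; the factor \<alpha> k comes from the chain rule. *)
definition online_loss ::
  "(nat \<Rightarrow> real) \<Rightarrow> (nat \<Rightarrow> real) \<Rightarrow> ('s \<Rightarrow> 'v \<Rightarrow> 'v) \<Rightarrow> (nat \<Rightarrow> 's) \<Rightarrow> (nat \<Rightarrow> 'v::real_vector)
     \<Rightarrow> nat \<Rightarrow> 'v" where
  "online_loss \<alpha> \<pi> est \<xi> z k = (\<alpha> k * \<pi> k) *\<^sub>R est (\<xi> k) (avg_iter \<alpha> z k)"

(* Index 0 of z and \<xi> is unused.  The online algorithm alg maps the list of the losses with
   indices 1, ..., k - 1 to the point z k.  It may also use internal randomness, through an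
   otherwise unrestricted seed; a deterministic algorithm is one that ignores the seed.
   The sample \<xi> k is independent of the whole vector (z 1, ..., z k); this is stated for the
   generated sigma-algebras, because indep_var needs both variables to have the same type. *)
definition averaged_online_scheme ::
  "'w measure \<Rightarrow> 's measure \<Rightarrow> real \<Rightarrow> (nat \<Rightarrow> real) \<Rightarrow> (nat \<Rightarrow> real) \<Rightarrow> ('s \<Rightarrow> 'v \<Rightarrow> 'v)
     \<Rightarrow> ('r \<Rightarrow> 'v list \<Rightarrow> 'v) \<Rightarrow> ('w \<Rightarrow> 'r) \<Rightarrow> (nat \<Rightarrow> 'w \<Rightarrow> 's) \<Rightarrow> (nat \<Rightarrow> 'w \<Rightarrow> 'v::euclidean_space)
     \<Rightarrow> bool" where
  "averaged_online_scheme M D R \<alpha> \<pi> est alg seed \<xi> z \<longleftrightarrow>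
     prob_space M \<and>
     (\<forall>k\<ge>1. 0 \<le> \<alpha> k \<and> \<alpha> k \<le> 1) \<and>
     (\<forall>k. 0 \<le> \<pi> k) \<and>
     (\<forall>k\<ge>1. \<pi> k * (1 - \<alpha> k) = \<pi> (k - 1)) \<and>
     (\<forall>k\<ge>1. z k \<in> borel_measurable M \<and>
        (\<forall>\<omega>\<in>space M. z k \<omega> \<in> cball 0 R \<and>
           z k \<omega> = alg (seed \<omega>)
             (map (online_loss \<alpha> \<pi> est (\<lambda>i. \<xi> i \<omega>) (\<lambda>i. z i \<omega>)) [1..<k]))) \<and>
     (\<forall>k\<ge>1. \<xi> k \<in> measurable M D \<and> distr M D (\<xi> k) = D \<and>
        prob_space.indep_set M
          (sets (vimage_algebra (space M) (\<xi> k) D))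
          (sets (vimage_algebra (space M) (\<lambda>\<omega>. \<lambda>i\<in>{1..k}. z i \<omega>) (\<Pi>\<^sub>M i\<in>{1..k}. borel))))"

definition regret :: "real \<Rightarrow> (nat \<Rightarrow> 'v::real_inner) \<Rightarrow> (nat \<Rightarrow> 'v) \<Rightarrow> nat \<Rightarrow> real" where
  "regret R z g K = (SUP y\<in>cball 0 R. \<Sum>k=1..K. (z k - y) \<bullet> g k)"

definition regret_bound ::
  "'w measure \<Rightarrow> real \<Rightarrow> real \<Rightarrow> (nat \<Rightarrow> 'w \<Rightarrow> 'v::real_inner) \<Rightarrow> (nat \<Rightarrow> 'w \<Rightarrow> 'v) \<Rightarrow> bool" where
  "regret_bound M C R z g \<longleftrightarrow>
     (\<forall>K\<ge>1. AE \<omega> in M. regret R (\<lambda>k. z k \<omega>) (\<lambda>k. g k \<omega>) K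
                       \<le> C * R * sqrt (\<Sum>k=1..K. (norm (g k \<omega>))\<^sup>2))"

definition max_gap :: "('v::real_normed_vector \<Rightarrow> real) \<Rightarrow> real \<Rightarrow> real \<Rightarrow> real" where
  "max_gap f fstar R = (SUP x\<in>cball 0 R. f x - fstar)"

(* A bare existential "\<exists>C'" in a polymorphic statement may be witnessed by a C' that depends on
   the instances of the type variables, here the dimension and the sample spaces, since types
   cannot be quantified below the existential.  Requiring C' \<le> const_cap C as well, with a
   monomorphic const_cap, is what makes C' depend on C only.  The value 16 is not optimized. *)
definition const_cap :: "real \<Rightarrow> real" where
  "const_cap C = 16 * C\<^sup>2"

end

theory Submission imports Defs begin

text \<open>
  Along every sample path, convexity telescopes \<open>k (f x\<^sub>k - f\<^sup>*)\<close> into the linear losses of the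
  exact gradients, whose expectation is that of the stochastic losses because \<open>\<xi>\<^sub>k\<close> is independent
  of \<open>(x\<^sub>k, z\<^sub>k)\<close>.  The regret bound, Minkowski's inequality and Jensen's inequality for the square
  root then show that \<open>a\<^sub>k = E [f x\<^sub>k - f\<^sup>*]\<close> satisfies
  \<open>k a\<^sub>k \<le> C R G\<^sub>0 \<surd>k + C R G\<^sub>1 \<surd>(F (a\<^sub>1 + \<dots> + a\<^sub>k))\<close>, where \<open>(f x\<^sub>j - f\<^sup>*)\<^sup>2 \<le> F (f x\<^sub>j - f\<^sup>*)\<close>
  was used.  Dividing by \<open>k\<close> and summing gives a quadratic inequality for \<open>\<surd>(a\<^sub>1 + \<dots> + a\<^sub>n)\<close>, whose
  harmonic-sum coefficient is the source of the logarithm in \<open>K\<close>.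
\<close>

section \<open>Deterministic estimates: the averaged recursion and the iteration count\<close>

text \<open>Telescoping: each term is at most the increment of \<open>2 * sqrt\<close>, which after
  clearing denominators is \<open>2 * s * t \<le> s\<^sup>2 + t\<^sup>2\<close> for neighbouring
  roots.\<close>

lemma sum_inverse_sqrt_le: "(\<Sum>k=1..n. 1 / sqrt (real k)) \<le> 2 * sqrt (real n)"
proof (induction n)
  case (Suc n)
  have "1 / sqrt (real (Suc n)) \<le> 2 * sqrt (real (Suc n)) - 2 * sqrt (real n)"
  proof -
    define s t where "s = sqrt (real (Suc n))" and "t = sqrt (real n)"
    have st: "s > 0" "s\<^sup>2 = t\<^sup>2 + 1" by (auto simp: s_def t_def)
    have "0 \<le> (s - t)\<^sup>2" by simp
    hence "2 * s * t \<le> s\<^sup>2 + t\<^sup>2" by (simp add: power2_diff)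
    hence "1 \<le> (2 * s - 2 * t) * s"
      using st by (simp add: algebra_simps power2_eq_square)
    thus ?thesis using st(1) unfolding s_def[symmetric] t_def[symmetric]
      by (simp add: divide_le_eq)
  qed
  thus ?case using Suc by simp
qed simp

text \<open>The difference of \<open>harm\<close> and \<open>ln\<close> decreases from its value 1
  at the index 1. The sequence in \<open>decseq_harm_diff_ln\<close> is shifted by one, hence the
  instances 0 and \<open>n - 1\<close>.\<close>

lemma harm_le_ln: "n \<ge> 1 \<Longrightarrow> harm n \<le> 1 + ln (real n)"
  using decseqD[OF decseq_harm_diff_ln, of 0 "n - 1"] by (simp add: harm_expand)

text \<open>Resolves a bound in which the unknown occurs on both sides: beyond
  \<open>q + sqrt p\<close>, both factors of \<open>(s - q) * s\<close> exceed
  \<open>sqrt p\<close>.\<close>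

lemma quadratic_bound:
  fixes s p q :: real
  assumes "s\<^sup>2 \<le> p + q * s" "0 \<le> p" "0 \<le> q"
  shows "s \<le> q + sqrt p"
proof (rule ccontr)
  assume "\<not> ?thesis"
  hence "s - q > sqrt p" "s > sqrt p" "sqrt p \<ge> 0" using assms by auto
  hence "sqrt p * sqrt p < (s - q) * s" by (intro mult_strict_mono') auto
  thus False using assms by (simp add: algebra_simps power2_eq_square)
qed

text \<open>Replacing every partial sum by the last one, \<open>S n\<close>, decouples the
  inequalities. Divided by \<open>k\<close> and summed, they bound \<open>S n\<close> in terms of
  \<open>sqrt (S n)\<close>; the solution of that quadratic inequality is put back into the
  inequality for index \<open>n\<close>.\<close>

lemma averaged_recursion_bound:
  fixes a :: "nat \<Rightarrow> real"
  assumes "0 \<le> b" "0 \<le> c" and a0: "\<And>k. 0 \<le> a k"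
    and rec: "\<And>k. 1 \<le> k \<Longrightarrow> k \<le> n \<Longrightarrow> k * a k \<le> c * sqrt k + b * sqrt (\<Sum>j=1..k. a j)"
    and n: "1 \<le> n"
  shows "a n \<le> c / sqrt n + b\<^sup>2 * harm n / n + b * sqrt (2 * c * sqrt n) / n"
proof -
  define S where "S k = (\<Sum>j=1..k. a j)" for k
  have a_le: "a k \<le> c * (1 / sqrt k) + b * sqrt (S n) * inverse (real k)" if "k \<in> {1..n}" for k
  proof -
    have "S k \<le> S n" unfolding S_def using that a0 by (intro sum_mono2) auto
    hence "b * sqrt (S k) \<le> b * sqrt (S n)" using assms by (intro mult_left_mono) auto
    hence "k * a k \<le> c * sqrt k + b * sqrt (S n)"
      using rec[of k] that unfolding S_def by auto
    hence "a k \<le> (c * sqrt k + b * sqrt (S n)) / k"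
      using that by (simp add: pos_le_divide_eq mult.commute)
    also have "\<dots> = c * (sqrt k / k) + b * sqrt (S n) * inverse (real k)"
      by (simp add: divide_inverse algebra_simps)
    also have "sqrt k / k = 1 / sqrt k"
      using that by (simp add: divide_simps)
    finally show ?thesis .
  qed
  have S0: "S n \<ge> 0" unfolding S_def using a0 by (intro sum_nonneg) auto
  have "S n \<le> (\<Sum>k=1..n. c * (1 / sqrt k) + b * sqrt (S n) * inverse (real k))"
    unfolding S_def[of n] using a_le by (intro sum_mono) (auto simp: S_def)
  also have "\<dots> = c * (\<Sum>k=1..n. 1 / sqrt k) + b * sqrt (S n) * harm n"
    by (simp only: sum.distrib sum_distrib_left harm_def)
  also have "\<dots> \<le> c * (2 * sqrt n) + b * sqrt (S n) * harm n"
    using sum_inverse_sqrt_le[of n] assms by (intro add_right_mono mult_left_mono) auto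
  \<comment> \<open>Now \<open>S n\<close> stands on both sides, once as a square: the form that
    \<open>quadratic_bound\<close> solves.\<close>
  finally have "(sqrt (S n))\<^sup>2 \<le> 2 * c * sqrt n + b * harm n * sqrt (S n)"
    using S0 by (simp add: algebra_simps)
  hence "sqrt (S n) \<le> b * harm n + sqrt (2 * c * sqrt n)"
    using assms by (intro quadratic_bound) (auto simp: harm_nonneg)
  hence "b * sqrt (S n) * inverse (real n) \<le>
      b * (b * harm n + sqrt (2 * c * sqrt n)) * inverse (real n)"
    using assms by (intro mult_right_mono mult_left_mono) auto
  moreover have "b * (b * harm n + sqrt (2 * c * sqrt n)) * inverse (real n) =
      b\<^sup>2 * harm n / n + b * sqrt (2 * c * sqrt n) / n"
    by (simp add: power2_eq_square divide_inverse algebra_simps)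
  ultimately show ?thesis using a_le[of n] n by simp
qed

text \<open>The lower bound on \<open>n\<close> dominates \<open>A\<^sup>2\<close>, \<open>B\<close>
  and \<open>B * L\<close>, where \<open>L\<close> is the logarithm; the upper bound serves to show
  that \<open>ln n\<close> is at most a multiple of \<open>L\<close>. The three summands cost 1, 3
  and 2 times \<open>C\<^sup>2 * \<epsilon>\<close>.\<close>

lemma iteration_count_bound:
  fixes A B C \<epsilon> :: real and n :: nat
  assumes "0 \<le> A" "0 \<le> B" "1 \<le> C" "0 < \<epsilon>" "1 \<le> n"
    and lower: "A\<^sup>2 + B * ln (exp 1 + A + B) \<le> n"
    and upper: "n \<le> A\<^sup>2 + B * ln (exp 1 + A + B) + 1"
    and c: "c = C * A * \<epsilon>" and b: "0 \<le> b" "b\<^sup>2 = C\<^sup>2 * B * \<epsilon>"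
  shows "c / sqrt n + b\<^sup>2 * harm n / n + b * sqrt (2 * c * sqrt n) / n \<le> 6 * C\<^sup>2 * \<epsilon>"
proof -
  define T where "T = exp 1 + A + B"
  define L where "L = ln T"
  have e: "exp (1::real) \<ge> 2" using exp_ge_add_one_self[of 1] by simp
  have T: "T \<ge> exp 1" "T > 0" using assms e by (auto simp: T_def)
  have "ln (exp 1) \<le> L" unfolding L_def using T by (subst ln_le_cancel_iff) auto
  hence L1: "L \<ge> 1" by simp
  have LT: "L \<le> T" unfolding L_def using T ln_less_self[of T] by linarith
  have low: "A\<^sup>2 + B * L \<le> n" and up: "n \<le> A\<^sup>2 + B * L + 1"
    using lower upper by (auto simp: L_def T_def)
  have n0: "real n > 0" using assms by simp
  have "B * L \<ge> B" using L1 assms mult_left_mono[of 1 L B] by simp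
  hence Bn: "B \<le> n" "B * L \<le> n" using low zero_le_power2[of A] assms by linarith+
  have "A\<^sup>2 \<le> n" using low \<open>B * L \<ge> B\<close> assms by linarith
  hence An: "A \<le> sqrt n" using assms real_le_rsqrt by blast
  have CC: "C \<le> C\<^sup>2" using assms by (simp add: power2_eq_square)

  have "real n \<le> A\<^sup>2 + B * T + 1" using up mult_left_mono[OF LT, of B] assms by simp
  \<comment> \<open>The right side is the expansion of \<open>T\<^sup>2\<close> with one product
    \<open>B * T\<close> kept together; its last term, at least 4, absorbs the 1 that comes from
    rounding up.\<close>
  also have "\<dots> \<le> A\<^sup>2 + B * T + A * B + exp 1 * A * 2 + exp 1 * B + exp 1 * exp 1"
  proof -
    have "0 \<le> A * B" "0 \<le> exp 1 * A * 2" "0 \<le> exp 1 * B"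
      using assms e by auto
    moreover have "2 * 2 \<le> exp 1 * exp (1::real)" by (intro mult_mono e) auto
    ultimately show ?thesis by linarith
  qed
  also have "\<dots> \<le> T\<^sup>2" unfolding T_def by (simp add: algebra_simps power2_eq_square)
  finally have "ln n \<le> ln (T\<^sup>2)" using n0 T by (subst ln_le_cancel_iff) auto
  also have "\<dots> = 2 * L" using T by (simp add: L_def ln_realpow)
  \<comment> \<open>The factor is 1 + 2: \<open>L1\<close> absorbs the constant of
    \<open>harm_le_ln\<close>, and \<open>ln n\<close> is at most \<open>2 * L\<close>.\<close>
  finally have H: "harm n \<le> 3 * L" using harm_le_ln[of n] assms L1 by linarith

  have 1: "c / sqrt n \<le> C\<^sup>2 * \<epsilon>"
  proof -
    have "c \<le> C * sqrt n * \<epsilon>" unfolding c using An assms by (intro mult_right_mono mult_left_mono) auto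
    hence "c / sqrt n \<le> C * \<epsilon>" using n0 by (simp add: divide_le_eq algebra_simps)
    also have "\<dots> \<le> C\<^sup>2 * \<epsilon>" using CC assms by simp
    finally show ?thesis .
  qed
  have 2: "b\<^sup>2 * harm n / n \<le> 3 * C\<^sup>2 * \<epsilon>"
  proof -
    have "B * harm n \<le> B * (3 * L)" using H assms by (intro mult_left_mono) auto
    also have "\<dots> \<le> 3 * n" using Bn by simp
    finally have "C\<^sup>2 * \<epsilon> * (B * harm n) \<le> C\<^sup>2 * \<epsilon> * (3 * n)"
      using assms by (intro mult_left_mono) auto
    thus ?thesis using n0 by (simp add: b divide_le_eq algebra_simps)
  qed
  have 3: "b * sqrt (2 * c * sqrt n) / n \<le> 2 * C\<^sup>2 * \<epsilon>"
  proof -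
    have c0: "0 \<le> c" using assms by simp
    \<comment> \<open>Comparing squares removes the nested root. With \<open>A \<le> sqrt n\<close>,
      \<open>B \<le> n\<close> and \<open>C \<le> C\<^sup>2\<close> the square is at most half of
      that of the target.\<close>
    have "(b * sqrt (2 * c * sqrt n))\<^sup>2 = b\<^sup>2 * (2 * c * sqrt n)"
      using c0 by (simp add: power_mult_distrib)
    also have "\<dots> = 2 * C\<^sup>2 * C * \<epsilon>\<^sup>2 * (B * (A * sqrt n))"
      unfolding b(2) c by (simp add: power2_eq_square algebra_simps)
    also have "\<dots> \<le> 2 * C\<^sup>2 * C\<^sup>2 * \<epsilon>\<^sup>2 * (real n * (sqrt n * sqrt n))"
      using assms Bn An CC by (intro mult_mono) auto
    also have "\<dots> \<le> (2 * C\<^sup>2 * \<epsilon> * n)\<^sup>2"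
      using assms(3,4) by (simp add: power2_eq_square algebra_simps)
    finally have "b * sqrt (2 * c * sqrt n) \<le> 2 * C\<^sup>2 * \<epsilon> * n"
      by (rule power2_le_imp_le) (use assms(4) in simp)
    thus ?thesis using n0 by (simp add: divide_le_eq)
  qed
  show ?thesis using 1 2 3 by linarith
qed

section \<open>Jensen's inequality and integration over an independent sample\<close>

text \<open>Jensen's inequality for the square root, obtained from the nonnegative variance of
  \<open>sqrt Y\<close>.\<close>

lemma (in prob_space) expectation_sqrt_le:
  fixes Y :: "'a \<Rightarrow> real"
  assumes Y: "integrable M Y" "\<And>\<omega>. 0 \<le> Y \<omega>" "expectation Y \<le> c"
  shows "integrable M (\<lambda>\<omega>. sqrt (Y \<omega>))" "expectation (\<lambda>\<omega>. sqrt (Y \<omega>)) \<le> sqrt c"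
proof -
  have sq: "(\<lambda>\<omega>. (sqrt (Y \<omega>))\<^sup>2) = Y" using Y by auto
  have [measurable]: "Y \<in> borel_measurable M" using Y by auto
  show int: "integrable M (\<lambda>\<omega>. sqrt (Y \<omega>))"
    by (rule square_integrable_imp_integrable) (simp_all add: sq Y)
  have "(expectation (\<lambda>\<omega>. sqrt (Y \<omega>)))\<^sup>2 \<le> expectation Y"
    using variance_positive[of "\<lambda>\<omega>. sqrt (Y \<omega>)"] variance_eq[OF int] Y by (simp add: sq)
  also have "\<dots> \<le> c" by fact
  finally show "expectation (\<lambda>\<omega>. sqrt (Y \<omega>)) \<le> sqrt c" by (rule real_le_rsqrt)
qed

text \<open>Turns independence of generated sigma-algebras into a product law. Events of
  \<open>h (Y \<omega>)\<close> lie in the sigma-algebra generated by \<open>Y\<close>, so the two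
  measures agree on rectangles, which determine them. The map \<open>h\<close> is there to pass from
  a tuple of points to the part of it that matters.\<close>

lemma (in prob_space) indep_vimage_pair_distr:
  assumes [measurable]: "\<xi> \<in> measurable M D" "Y \<in> measurable M N" "h \<in> measurable N L"
    and law: "distr M D \<xi> = D"
    and ind: "indep_set (sets (vimage_algebra (space M) \<xi> D)) (sets (vimage_algebra (space M) Y N))"
  shows "distr M (D \<Otimes>\<^sub>M L) (\<lambda>\<omega>. (\<xi> \<omega>, h (Y \<omega>))) = D \<Otimes>\<^sub>M distr M L (\<lambda>\<omega>. h (Y \<omega>))"
proof (rule pair_measure_eqI[symmetric])
  interpret L: prob_space "distr M L (\<lambda>\<omega>. h (Y \<omega>))" by (rule prob_space_distr) simp
  have "prob_space (distr M D \<xi>)" by (rule prob_space_distr) simp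
  then interpret D: prob_space D by (simp add: law)
  show "sigma_finite_measure D" "sigma_finite_measure (distr M L (\<lambda>\<omega>. h (Y \<omega>)))"
    by unfold_locales
  show "sets (D \<Otimes>\<^sub>M distr M L (\<lambda>\<omega>. h (Y \<omega>))) = sets (distr M (D \<Otimes>\<^sub>M L) (\<lambda>\<omega>. (\<xi> \<omega>, h (Y \<omega>))))"
    by (simp cong: sets_pair_measure_cong)
  fix A B assume A[measurable]: "A \<in> sets D" and "B \<in> sets (distr M L (\<lambda>\<omega>. h (Y \<omega>)))"
  hence B[measurable]: "B \<in> sets L" by simp
  have hB: "h -` B \<inter> space N \<in> sets N" by measurable
  have "(\<lambda>\<omega>. h (Y \<omega>)) -` B \<inter> space M = Y -` (h -` B \<inter> space N) \<inter> space M"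
    using measurable_space[OF \<open>Y \<in> measurable M N\<close>] by auto
  hence *: "(\<lambda>\<omega>. h (Y \<omega>)) -` B \<inter> space M \<in> sets (vimage_algebra (space M) Y N)"
    using in_vimage_algebra[OF hB] by simp
  have "emeasure D A * emeasure (distr M L (\<lambda>\<omega>. h (Y \<omega>))) B =
      emeasure (distr M D \<xi>) A * emeasure (distr M L (\<lambda>\<omega>. h (Y \<omega>))) B" by (simp add: law)
  also have "\<dots> = ennreal (prob (\<xi> -` A \<inter> space M) * prob ((\<lambda>\<omega>. h (Y \<omega>)) -` B \<inter> space M))"
    by (simp add: emeasure_distr emeasure_eq_measure ennreal_mult)
  also have "prob (\<xi> -` A \<inter> space M) * prob ((\<lambda>\<omega>. h (Y \<omega>)) -` B \<inter> space M) =
     prob ((\<xi> -` A \<inter> space M) \<inter> ((\<lambda>\<omega>. h (Y \<omega>)) -` B \<inter> space M))"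
    using indep_setD[OF ind in_vimage_algebra[OF A] *] by simp
  also have "(\<xi> -` A \<inter> space M) \<inter> ((\<lambda>\<omega>. h (Y \<omega>)) -` B \<inter> space M)
      = (\<lambda>\<omega>. (\<xi> \<omega>, h (Y \<omega>))) -` (A \<times> B) \<inter> space M" by auto
  also have "ennreal (prob \<dots>) = emeasure (distr M (D \<Otimes>\<^sub>M L) (\<lambda>\<omega>. (\<xi> \<omega>, h (Y \<omega>)))) (A \<times> B)"
    by (simp add: emeasure_distr emeasure_eq_measure)
  finally show "emeasure D A * emeasure (distr M L (\<lambda>\<omega>. h (Y \<omega>))) B =
    emeasure (distr M (D \<Otimes>\<^sub>M L) (\<lambda>\<omega>. (\<xi> \<omega>, h (Y \<omega>)))) (A \<times> B)" .
qed

text \<open>The product form in \<open>joint\<close> says at once that the sample has law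
  \<open>D\<close> and that it is independent of \<open>Y\<close>. It lets Fubini's theorem take the
  place of conditioning: \<open>Y\<close> is frozen and the sample integrated out.\<close>

locale fresh_sample = M: prob_space M + D: prob_space D
  for M :: "'w measure" and D :: "'s measure" +
  fixes L :: "'y measure" and \<xi> :: "'w \<Rightarrow> 's" and Y :: "'w \<Rightarrow> 'y"
  assumes sample_measurable[measurable]: "\<xi> \<in> measurable M D"
    and point_measurable[measurable]: "Y \<in> measurable M L"
    and joint: "distr M (D \<Otimes>\<^sub>M L) (\<lambda>\<omega>. (\<xi> \<omega>, Y \<omega>)) = D \<Otimes>\<^sub>M distr M L Y"
begin

sublocale Y: prob_space "distr M L Y" by (rule M.prob_space_distr) simp
sublocale DY: pair_prob_space D "distr M L Y" ..

lemma sets_joint: "sets (D \<Otimes>\<^sub>M distr M L Y) = sets (D \<Otimes>\<^sub>M L)"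
  by (simp cong: sets_pair_measure_cong)

text \<open>The exceptional null set may depend on \<open>y\<close>. Joint measurability makes the
  union of these sections a null set of the product, and \<open>joint\<close> carries it over to
  \<open>M\<close>.\<close>

lemma AE_sample:
  assumes [measurable]: "Measurable.pred (D \<Otimes>\<^sub>M L) (\<lambda>(s, y). P s y)"
    and "\<And>y. AE s in D. P s y"
  shows "AE \<omega> in M. P (\<xi> \<omega>) (Y \<omega>)"
proof -
  have [measurable]: "Measurable.pred (D \<Otimes>\<^sub>M distr M L Y) (\<lambda>(s, y). P s y)"
    using assms(1) unfolding measurable_cong_sets[OF sets_joint refl] .
  have sets: "{x \<in> space (D \<Otimes>\<^sub>M distr M L Y). P (fst x) (snd x)} \<in> sets (D \<Otimes>\<^sub>M distr M L Y)"
    by (rule predE) (use assms(1) in \<open>simp add: case_prod_beta measurable_cong_sets[OF sets_joint refl]\<close>)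
  have "AE y in distr M L Y. AE s in D. P s y" using assms by simp
  \<comment> \<open>The hypothesis has \<open>y\<close> outermost, whereas
    \<open>DY.AE_pair_measure\<close> wants the first coordinate \<open>s\<close> outermost.\<close>
  hence "AE s in D. AE y in distr M L Y. P s y"
    by (subst DY.AE_commute[OF sets])
  hence "AE p in D \<Otimes>\<^sub>M distr M L Y. (\<lambda>(s, y). P s y) p"
    using sets by (intro DY.AE_pair_measure) (auto simp: case_prod_beta)
  hence "AE p in distr M (D \<Otimes>\<^sub>M L) (\<lambda>\<omega>. (\<xi> \<omega>, Y \<omega>)). (\<lambda>(s, y). P s y) p"
    unfolding joint .
  thus ?thesis by (subst (asm) AE_distr_iff) auto
qed

lemma nn_integral_sample:
  assumes h[measurable]: "(\<lambda>(s, y). h s y) \<in> borel_measurable (D \<Otimes>\<^sub>M L)"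
  shows "(\<integral>\<^sup>+\<omega>. h (\<xi> \<omega>) (Y \<omega>) \<partial>M) = (\<integral>\<^sup>+\<omega>. (\<integral>\<^sup>+s. h s (Y \<omega>) \<partial>D) \<partial>M)"
proof -
  have h'[measurable]: "(\<lambda>(s, y). h s y) \<in> borel_measurable (D \<Otimes>\<^sub>M distr M L Y)"
    using h unfolding measurable_cong_sets[OF sets_joint refl] .
  have "(\<integral>\<^sup>+\<omega>. h (\<xi> \<omega>) (Y \<omega>) \<partial>M) =
      (\<integral>\<^sup>+p. (\<lambda>(s, y). h s y) p \<partial>distr M (D \<Otimes>\<^sub>M L) (\<lambda>\<omega>. (\<xi> \<omega>, Y \<omega>)))"
    by (subst nn_integral_distr) auto
  also have "\<dots> = (\<integral>\<^sup>+y. (\<integral>\<^sup>+s. h s y \<partial>D) \<partial>distr M L Y)"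
    by (simp add: joint flip: DY.nn_integral_snd)
  also have "\<dots> = (\<integral>\<^sup>+\<omega>. (\<integral>\<^sup>+s. h s (Y \<omega>) \<partial>D) \<partial>M)"
    by (subst nn_integral_distr) auto
  finally show ?thesis .
qed

lemma integral_sample:
  fixes h :: "'s \<Rightarrow> 'y \<Rightarrow> real"
  assumes h[measurable]: "(\<lambda>(s, y). h s y) \<in> borel_measurable (D \<Otimes>\<^sub>M L)"
    and int: "integrable M (\<lambda>\<omega>. h (\<xi> \<omega>) (Y \<omega>))"
  shows "integrable M (\<lambda>\<omega>. \<integral>s. h s (Y \<omega>) \<partial>D)"
    and "(\<integral>\<omega>. h (\<xi> \<omega>) (Y \<omega>) \<partial>M) = (\<integral>\<omega>. (\<integral>s. h s (Y \<omega>) \<partial>D) \<partial>M)"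
proof -
  have "integrable (distr M (D \<Otimes>\<^sub>M L) (\<lambda>\<omega>. (\<xi> \<omega>, Y \<omega>))) (\<lambda>(s, y). h s y)"
    using int by (subst integrable_distr_eq) auto
  hence i: "integrable (D \<Otimes>\<^sub>M distr M L Y) (\<lambda>(s, y). h s y)" by (simp add: joint)
  have m[measurable]: "(\<lambda>y. \<integral>s. h s y \<partial>D) \<in> borel_measurable L" by measurable
  show "integrable M (\<lambda>\<omega>. \<integral>s. h s (Y \<omega>) \<partial>D)"
    using DY.integrable_snd[OF i] by (subst (asm) integrable_distr_eq) auto
  have "(\<integral>\<omega>. h (\<xi> \<omega>) (Y \<omega>) \<partial>M) =
      (\<integral>p. (\<lambda>(s, y). h s y) p \<partial>distr M (D \<Otimes>\<^sub>M L) (\<lambda>\<omega>. (\<xi> \<omega>, Y \<omega>)))"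
    by (subst integral_distr) auto
  also have "\<dots> = (\<integral>y. (\<integral>s. h s y \<partial>D) \<partial>distr M L Y)"
    using DY.integral_snd[OF i] by (simp add: joint)
  also have "\<dots> = (\<integral>\<omega>. (\<integral>s. h s (Y \<omega>) \<partial>D) \<partial>M)"
    by (subst integral_distr) auto
  finally show "(\<integral>\<omega>. h (\<xi> \<omega>) (Y \<omega>) \<partial>M) = (\<integral>\<omega>. (\<integral>s. h s (Y \<omega>) \<partial>D) \<partial>M)" .
qed

text \<open>Tonelli's theorem with absolute values gives integrability, which then licenses Fubini's
  theorem for the bound. The conditions concern only attained values of \<open>Y\<close>, since the
  later estimates hold only for points of the ball.\<close>

lemma integrable_sample_bounded:
  fixes h :: "'s \<Rightarrow> 'y \<Rightarrow> real"
  assumes h[measurable]: "(\<lambda>(s, y). h s y) \<in> borel_measurable (D \<Otimes>\<^sub>M L)"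
    and int: "\<And>\<omega>. \<omega> \<in> space M \<Longrightarrow> integrable D (\<lambda>s. h s (Y \<omega>))"
    and le: "\<And>\<omega>. \<omega> \<in> space M \<Longrightarrow> (\<integral>s. \<bar>h s (Y \<omega>)\<bar> \<partial>D) \<le> c"
  shows "integrable M (\<lambda>\<omega>. h (\<xi> \<omega>) (Y \<omega>))"
    and "(\<integral>\<omega>. h (\<xi> \<omega>) (Y \<omega>) \<partial>M) \<le> c"
proof -
  have "(\<integral>\<^sup>+\<omega>. ennreal \<bar>h (\<xi> \<omega>) (Y \<omega>)\<bar> \<partial>M) = (\<integral>\<^sup>+\<omega>. (\<integral>\<^sup>+s. ennreal \<bar>h s (Y \<omega>)\<bar> \<partial>D) \<partial>M)"
    by (rule nn_integral_sample) measurable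
  also have "\<dots> = (\<integral>\<^sup>+\<omega>. ennreal (\<integral>s. \<bar>h s (Y \<omega>)\<bar> \<partial>D) \<partial>M)"
    using int by (intro nn_integral_cong nn_integral_eq_integral) auto
  also have "\<dots> \<le> (\<integral>\<^sup>+\<omega>. ennreal c \<partial>M)"
    using le by (intro nn_integral_mono ennreal_leI) auto
  also have "\<dots> < \<infinity>" by (simp add: M.emeasure_space_1)
  finally show i: "integrable M (\<lambda>\<omega>. h (\<xi> \<omega>) (Y \<omega>))"
    by (intro integrableI_bounded) auto
  have "(\<integral>\<omega>. h (\<xi> \<omega>) (Y \<omega>) \<partial>M) = (\<integral>\<omega>. (\<integral>s. h s (Y \<omega>) \<partial>D) \<partial>M)"
    by (rule integral_sample(2)[OF h i])
  also have "\<dots> \<le> c"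
  proof (rule M.integral_le_const[OF integral_sample(1)[OF h i]], rule AE_I2)
    fix \<omega> assume w: "\<omega> \<in> space M"
    have "(\<integral>s. h s (Y \<omega>) \<partial>D) \<le> (\<integral>s. \<bar>h s (Y \<omega>)\<bar> \<partial>D)"
      using int[OF w] by (intro integral_mono) auto
    thus "(\<integral>s. h s (Y \<omega>) \<partial>D) \<le> c" using le[OF w] by linarith
  qed
  finally show "(\<integral>\<omega>. h (\<xi> \<omega>) (Y \<omega>) \<partial>M) \<le> c" .
qed

end

section \<open>Averaged iterates, online-to-batch conversion and finite suprema\<close>

lemma avg_iter_cong:
  "(\<And>i. i \<in> {1..k} \<Longrightarrow> z i = z' i) \<Longrightarrow> avg_iter \<alpha> z k = avg_iter \<alpha> z' k"
  by (induction k) auto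

lemma measurable_avg_iter:
  fixes z :: "nat \<Rightarrow> 'w \<Rightarrow> 'v::euclidean_space"
  assumes "\<And>i. i \<in> {1..k} \<Longrightarrow> z i \<in> borel_measurable M"
  shows "(\<lambda>\<omega>. avg_iter \<alpha> (\<lambda>i. z i \<omega>) k) \<in> borel_measurable M"
  using assms
proof (induction k)
  case (Suc k)
  have [measurable]: "(\<lambda>\<omega>. avg_iter \<alpha> (\<lambda>i. z i \<omega>) k) \<in> borel_measurable M"
    "z (Suc k) \<in> borel_measurable M"
    using Suc by auto
  show ?case by simp
qed simp

lemma norm_avg_iter_le:
  assumes "\<And>i. 1 \<le> i \<Longrightarrow> 0 \<le> \<alpha> i \<and> \<alpha> i \<le> 1" "\<And>i. 1 \<le> i \<Longrightarrow> norm (z i) \<le> R" "0 \<le> R"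
  shows "norm (avg_iter \<alpha> z k) \<le> R"
proof (induction k)
  case (Suc k)
  have a: "0 \<le> \<alpha> (Suc k)" "\<alpha> (Suc k) \<le> 1" using assms(1)[of "Suc k"] by auto
  have "norm (avg_iter \<alpha> z (Suc k)) \<le>
      (1 - \<alpha> (Suc k)) * norm (avg_iter \<alpha> z k) + \<alpha> (Suc k) * norm (z (Suc k))"
    using a by (auto intro: order_trans[OF norm_triangle_ineq])
  also have "\<dots> \<le> R" using a Suc assms(2)[of "Suc k"] by (intro convex_bound_le) auto
  finally show ?case .
qed (use assms in simp)

text \<open>With weights \<open>1 / k\<close> the new point \<open>z (Suc k)\<close> is the
  increment of \<open>real k *\<^sub>R x k\<close>. Hence its distance vector to \<open>y\<close> is
  \<open>k\<close> times the last move of the average plus the vector from \<open>y\<close> to the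
  new average. The subgradient at the new average, tested against the old average and against
  \<open>y\<close>, makes the sum telescope.\<close>

lemma anytime_online_to_batch:
  fixes z :: "nat \<Rightarrow> 'v::real_inner"
  defines "x \<equiv> avg_iter (\<lambda>k. 1 / real k) z"
  assumes "\<And>k. h k \<in> subdifferential f (x k)"
  shows "real k * (f (x k) - f y) \<le> (\<Sum>j=1..k. (z j - y) \<bullet> h j)"
proof (induction k)
  case (Suc k)
  have "real (Suc k) *\<^sub>R x (Suc k) = real k *\<^sub>R x k + z (Suc k)"
    by (simp add: x_def scaleR_add_right divide_simps)
  hence "z (Suc k) = real (Suc k) *\<^sub>R x (Suc k) - real k *\<^sub>R x k" by simp
  hence z: "z (Suc k) - y = real k *\<^sub>R (x (Suc k) - x k) + (x (Suc k) - y)"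
    by (simp add: algebra_simps)
  have sub: "f (x (Suc k)) + h (Suc k) \<bullet> (w - x (Suc k)) \<le> f w" for w
    using assms(2)[of "Suc k"] by (auto simp: subdifferential_def)
  have "f (x (Suc k)) - f w \<le> (x (Suc k) - w) \<bullet> h (Suc k)" for w
    using sub[of w] by (simp add: inner_diff_left inner_diff_right inner_commute)
  \<comment> \<open>The first instance is taken \<open>k\<close> times and the second once, matching
    the decomposition \<open>z\<close>.\<close>
  from this[of "x k"] this[of y]
  have "real k * (f (x (Suc k)) - f (x k)) + (f (x (Suc k)) - f y) \<le> (z (Suc k) - y) \<bullet> h (Suc k)"
    unfolding z inner_add_left inner_scaleR_left by (intro add_mono mult_left_mono) auto
  thus ?case using Suc by (simp add: algebra_simps)
qed simp

text \<open>A real \<open>SUP\<close> dominates its members only if they are bounded above;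
  compactness of the ball supplies this, here and in \<open>le_max_gap\<close>.\<close>

lemma le_regret:
  fixes z :: "nat \<Rightarrow> 'v::euclidean_space"
  assumes "norm y \<le> R"
  shows "(\<Sum>k=1..K. (z k - y) \<bullet> g k) \<le> regret R z g K"
  unfolding regret_def
proof (rule cSUP_upper)
  have "compact ((\<lambda>y. \<Sum>k=1..K. (z k - y) \<bullet> g k) ` cball 0 R)"
    by (intro compact_continuous_image continuous_intros compact_cball)
  thus "bdd_above ((\<lambda>y. \<Sum>k=1..K. (z k - y) \<bullet> g k) ` cball 0 R)"
    by (intro bounded_imp_bdd_above compact_imp_bounded)
qed (use assms in simp)

lemma le_max_gap:
  fixes f :: "'v::euclidean_space \<Rightarrow> real"
  assumes "continuous_on UNIV f" "norm x \<le> R"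
  shows "f x - c \<le> max_gap f c R"
  unfolding max_gap_def
proof (rule cSUP_upper)
  have "compact ((\<lambda>x. f x - c) ` cball 0 R)"
    by (intro compact_continuous_image continuous_intros compact_cball
      continuous_on_subset[OF assms(1)]) auto
  thus "bdd_above ((\<lambda>x. f x - c) ` cball 0 R)"
    by (intro bounded_imp_bdd_above compact_imp_bounded)
qed (use assms in simp)

section \<open>The recursion for the expected gap\<close>

text \<open>The average and the online point with index \<open>k\<close> are both measurable
  functions of the tuple of points with indices 1 to \<open>k\<close>, and that tuple is what the
  sample is independent of.\<close>

lemma averaged_online_scheme_fresh_sample:
  fixes z :: "nat \<Rightarrow> 'w \<Rightarrow> 'v::euclidean_space"
  assumes scheme: "averaged_online_scheme M D R \<alpha> \<pi> est alg seed \<xi> z"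
    and k: "1 \<le> k"
  shows "fresh_sample M D (borel \<Otimes>\<^sub>M borel) (\<xi> k) (\<lambda>\<omega>. (avg_iter \<alpha> (\<lambda>i. z i \<omega>) k, z k \<omega>))"
proof -
  interpret prob_space M using scheme by (simp add: averaged_online_scheme_def)
  have z[measurable]: "z i \<in> borel_measurable M" if "1 \<le> i" for i
    using scheme that by (simp add: averaged_online_scheme_def)
  have \<xi>[measurable]: "\<xi> k \<in> measurable M D" and law: "distr M D (\<xi> k) = D"
    and ind: "indep_set (sets (vimage_algebra (space M) (\<xi> k) D))
      (sets (vimage_algebra (space M) (\<lambda>\<omega>. \<lambda>i\<in>{1..k}. z i \<omega>) (\<Pi>\<^sub>M i\<in>{1..k}. borel)))"
    using scheme k by (auto simp: averaged_online_scheme_def)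
  have Z: "(\<lambda>\<omega>. \<lambda>i\<in>{1..k}. z i \<omega>) \<in> measurable M (\<Pi>\<^sub>M i\<in>{1..k}. borel)"
    by (intro measurable_restrict z) auto
  have comp: "(\<lambda>Z::nat \<Rightarrow> 'v. Z i) \<in> borel_measurable (\<Pi>\<^sub>M i\<in>{1..k}. borel)" if "i \<in> {1..k}" for i
    using that by (rule measurable_component_singleton)
  have h: "(\<lambda>Z. (avg_iter \<alpha> Z k, Z k)) \<in> measurable (\<Pi>\<^sub>M i\<in>{1..k}. borel) (borel \<Otimes>\<^sub>M (borel::'v measure))"
    using k by (intro measurable_Pair measurable_avg_iter[of k "\<lambda>i Z. Z i"] comp) auto
  \<comment> \<open>The restricted tuple is undefined elsewhere, but neither component reads an
    index outside 1 to \<open>k\<close>.\<close>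
  have *: "avg_iter \<alpha> (\<lambda>i\<in>{1..k}. z i \<omega>) k = avg_iter \<alpha> (\<lambda>i. z i \<omega>) k"
    "(\<lambda>i\<in>{1..k}. z i \<omega>) k = z k \<omega>" for \<omega>
    using k by (auto intro!: avg_iter_cong)
  have "prob_space (distr M D (\<xi> k))" by (rule prob_space_distr) simp
  then interpret D: prob_space D by (simp add: law)
  show ?thesis
  proof
    show "\<xi> k \<in> measurable M D" by simp
    show "(\<lambda>\<omega>. (avg_iter \<alpha> (\<lambda>i. z i \<omega>) k, z k \<omega>)) \<in> measurable M (borel \<Otimes>\<^sub>M borel)"
      using k by (intro measurable_Pair measurable_avg_iter z) auto
    show "distr M (D \<Otimes>\<^sub>M (borel \<Otimes>\<^sub>M borel)) (\<lambda>\<omega>. (\<xi> k \<omega>, avg_iter \<alpha> (\<lambda>i. z i \<omega>) k, z k \<omega>)) =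
      D \<Otimes>\<^sub>M distr M (borel \<Otimes>\<^sub>M borel) (\<lambda>\<omega>. (avg_iter \<alpha> (\<lambda>i. z i \<omega>) k, z k \<omega>))"
      using indep_vimage_pair_distr[OF \<xi> Z h law ind] unfolding * .
  qed
qed

text \<open>The sum on the right includes \<open>a k\<close> itself, because the loss with index
  \<open>k\<close> is evaluated at the average that already contains \<open>z k\<close>. The
  inequality is therefore implicit, and it is left to \<open>averaged_recursion_bound\<close> to
  resolve it.\<close>

lemma expected_gap_recursion:
  fixes M :: "'w measure" and f :: "'v::euclidean_space \<Rightarrow> real" and xs :: 'v
    and z :: "nat \<Rightarrow> 'w \<Rightarrow> 'v" and k :: nat
  defines "x \<equiv> \<lambda>k \<omega>. avg_iter (\<lambda>k. 1 / real k) (\<lambda>i. z i \<omega>) k"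
  defines "a \<equiv> \<lambda>k::nat. prob_space.expectation M (\<lambda>\<omega>. f (x k \<omega>) - f xs)"
  assumes cont: "continuous_on UNIV f" and min: "\<And>y. f xs \<le> f y" and xs: "norm xs \<le> R"
    and R: "0 < R" and C: "0 \<le> C"
    and lip: "stoch_gen_lipschitz D f (f xs) grad est G0 G1"
    and scheme: "averaged_online_scheme M D R (\<lambda>k. 1 / real k) real est alg seed \<xi> z"
    and reg: "regret_bound M C R z
         (\<lambda>k \<omega>. online_loss (\<lambda>k. 1 / real k) real est (\<lambda>i. \<xi> i \<omega>) (\<lambda>i. z i \<omega>) k)"
    and k: "1 \<le> k"
  shows "real k * a k \<le> C * R * G0 * sqrt k + C * R * G1 * sqrt (max_gap f (f xs) R) * sqrt (\<Sum>j=1..k. a j)"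
proof -
  interpret prob_space M using scheme by (simp add: averaged_online_scheme_def)
  define F where "F = max_gap f (f xs) R"
  define r where "r j \<omega> = f (x j \<omega>) - f xs" for j \<omega>
  have [measurable]: "f \<in> borel_measurable borel" using cont by (rule borel_measurable_continuous_onI)
  interpret D: prob_space D using lip by (simp add: stoch_gen_lipschitz_def)
  have G: "0 \<le> G0" "0 \<le> G1" and grad: "\<And>y. grad y \<in> subdifferential f y"
    and est_m[measurable]: "(\<lambda>(s, y). est s y) \<in> borel_measurable (D \<Otimes>\<^sub>M borel)"
    and est_mean: "\<And>y. has_bochner_integral D (\<lambda>s. est s y) (grad y)"
    using lip by (auto simp: stoch_gen_lipschitz_def)
  obtain u v where u_m[measurable]: "(\<lambda>(s, y). u s y) \<in> borel_measurable (D \<Otimes>\<^sub>M borel)"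
    and v_m[measurable]: "(\<lambda>(s, y). v s y) \<in> borel_measurable (D \<Otimes>\<^sub>M borel)"
    and est_eq: "\<And>s y. s \<in> space D \<Longrightarrow> est s y = u s y + v s y"
    and u_int: "\<And>y. integrable D (\<lambda>s. (norm (u s y))\<^sup>2)"
    and u_le: "\<And>y. (\<integral>s. (norm (u s y))\<^sup>2 \<partial>D) \<le> G0\<^sup>2"
    and v_le: "\<And>y. AE s in D. norm (v s y) \<le> G1 * (f y - f xs)"
    using lip unfolding stoch_gen_lipschitz_def by blast
  have z_le: "norm (z j \<omega>) \<le> R" if "1 \<le> j" "\<omega> \<in> space M" for j \<omega>
  proof -
    have "z j \<omega> \<in> cball 0 R" using scheme that unfolding averaged_online_scheme_def by blast
    thus ?thesis by simp
  qed
  have x_le: "norm (x j \<omega>) \<le> R" if "\<omega> \<in> space M" for j \<omega>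
    unfolding x_def using z_le R that by (intro norm_avg_iter_le) auto
  have z_m: "z j \<in> borel_measurable M" if "1 \<le> j" for j
    using scheme that by (simp add: averaged_online_scheme_def)
  have x_m[measurable]: "x j \<in> borel_measurable M" for j
    unfolding x_def using z_m by (intro measurable_avg_iter) auto
  have r_m[measurable]: "r j \<in> borel_measurable M" for j unfolding r_def by measurable
  have r0: "0 \<le> r j \<omega>" for j \<omega> using min by (simp add: r_def)
  have rF: "r j \<omega> \<le> F" if "\<omega> \<in> space M" for j \<omega>
    unfolding r_def F_def using le_max_gap[OF cont x_le[OF that]] .
  have F0: "0 \<le> F" using le_max_gap[OF cont xs, of "f xs"] by (simp add: F_def)
  have r_int: "integrable M (r j)" for j
    by (rule integrable_const_bound[of _ F]) (use r0 rF in auto)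
  have r2_int: "integrable M (\<lambda>\<omega>. (r j \<omega>)\<^sup>2)" for j
    by (rule integrable_const_bound[of _ "F\<^sup>2"]) (use r0 rF in \<open>auto intro!: power_mono\<close>)
  have a: "a j = expectation (r j)" for j by (simp add: a_def r_def[abs_def])

  have fresh: "fresh_sample M D (borel \<Otimes>\<^sub>M borel) (\<xi> j) (\<lambda>\<omega>. (x j \<omega>, z j \<omega>))" if "1 \<le> j" for j
    unfolding x_def by (rule averaged_online_scheme_fresh_sample[OF scheme that])

  have u2: "integrable M (\<lambda>\<omega>. (norm (u (\<xi> j \<omega>) (x j \<omega>)))\<^sup>2) \<and>
      expectation (\<lambda>\<omega>. (norm (u (\<xi> j \<omega>) (x j \<omega>)))\<^sup>2) \<le> G0\<^sup>2" if "1 \<le> j" for j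
  proof -
    interpret fresh_sample M D "borel \<Otimes>\<^sub>M borel" "\<xi> j" "\<lambda>\<omega>. (x j \<omega>, z j \<omega>)" by (rule fresh[OF that])
    show ?thesis
      using integrable_sample_bounded[where h = "\<lambda>s y. (norm (u s (fst y)))\<^sup>2" and c = "G0\<^sup>2"] u_int u_le
      by (simp add: case_prod_beta)
  qed
  have v: "AE \<omega> in M. norm (v (\<xi> j \<omega>) (x j \<omega>)) \<le> G1 * r j \<omega>" if "1 \<le> j" for j
  proof -
    interpret fresh_sample M D "borel \<Otimes>\<^sub>M borel" "\<xi> j" "\<lambda>\<omega>. (x j \<omega>, z j \<omega>)" by (rule fresh[OF that])
    show ?thesis unfolding r_def
      using AE_sample[where P = "\<lambda>s y. norm (v s (fst y)) \<le> G1 * (f (fst y) - f xs)"] v_le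
      by (simp add: case_prod_beta)
  qed
  have est: "integrable M (\<lambda>\<omega>. (z j \<omega> - xs) \<bullet> est (\<xi> j \<omega>) (x j \<omega>)) \<and>
      integrable M (\<lambda>\<omega>. (z j \<omega> - xs) \<bullet> grad (x j \<omega>)) \<and>
      expectation (\<lambda>\<omega>. (z j \<omega> - xs) \<bullet> est (\<xi> j \<omega>) (x j \<omega>)) =
      expectation (\<lambda>\<omega>. (z j \<omega> - xs) \<bullet> grad (x j \<omega>))" if j: "1 \<le> j" for j
  proof -
    interpret fresh_sample M D "borel \<Otimes>\<^sub>M borel" "\<xi> j" "\<lambda>\<omega>. (x j \<omega>, z j \<omega>)" by (rule fresh[OF j])
    define h where "h s y = (snd y - xs) \<bullet> est s (fst y)" for s y
    have h_m: "(\<lambda>(s, y). h s y) \<in> borel_measurable (D \<Otimes>\<^sub>M (borel \<Otimes>\<^sub>M borel))"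
      unfolding h_def by (simp add: case_prod_beta)
    have h_int: "has_bochner_integral D (\<lambda>s. h s y) ((snd y - xs) \<bullet> grad (fst y))" for y
      unfolding h_def by (intro has_bochner_integral_inner_right est_mean)
    \<comment> \<open>A crude bound that serves integrability alone; its constant does not reach the
      final estimate. Bounding the norm of \<open>u\<close> by 1 plus its square makes the second
      moment sufficient.\<close>
    have est_norm: "(\<integral>s. norm (est s y) \<partial>D) \<le> 1 + G0\<^sup>2 + G1 * F" if "f y - f xs \<le> F" for y
    proof -
      have "(\<integral>s. norm (est s y) \<partial>D) \<le> (\<integral>s. 1 + (norm (u s y))\<^sup>2 + G1 * F \<partial>D)"
      proof (rule integral_mono_AE)
        show "integrable D (\<lambda>s. norm (est s y))"
          using est_mean by (intro integrable_norm) (auto simp: has_bochner_integral_iff)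
        show "AE s in D. norm (est s y) \<le> 1 + (norm (u s y))\<^sup>2 + G1 * F"
          using v_le[of y] AE_space
        proof eventually_elim
          case (elim s)
          have "G1 * (f y - f xs) \<le> G1 * F" using that G by (intro mult_left_mono)
          moreover have "norm (u s y) \<le> 1 + (norm (u s y))\<^sup>2"
          proof -
            have "0 \<le> (norm (u s y) - 1/2)\<^sup>2" by simp
            thus ?thesis by (simp add: power2_eq_square algebra_simps)
          qed
          ultimately show ?case
            using elim norm_triangle_ineq[of "u s y" "v s y"] est_eq[of s y] by simp
        qed
      qed (use u_int in auto)
      also have "\<dots> \<le> 1 + G0\<^sup>2 + G1 * F" using u_int u_le by (simp add: D.prob_space)
      finally show ?thesis .
    qed
    have h_bd: "(\<integral>s. \<bar>h s (x j \<omega>, z j \<omega>)\<bar> \<partial>D) \<le> 2 * R * (1 + G0\<^sup>2 + G1 * F)" if w: "\<omega> \<in> space M" for \<omega>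
    proof -
      have "norm (z j \<omega> - xs) \<le> 2 * R"
        using z_le[OF j w] xs norm_triangle_ineq4[of "z j \<omega>" xs] by linarith
      hence "\<bar>h s (x j \<omega>, z j \<omega>)\<bar> \<le> 2 * R * norm (est s (x j \<omega>))" for s
        unfolding h_def fst_conv snd_conv
        by (intro order_trans[OF Cauchy_Schwarz_ineq2] mult_right_mono) auto
      hence "(\<integral>s. \<bar>h s (x j \<omega>, z j \<omega>)\<bar> \<partial>D) \<le> (\<integral>s. 2 * R * norm (est s (x j \<omega>)) \<partial>D)"
        using h_int est_mean
        by (intro integral_mono) (auto simp: has_bochner_integral_iff intro!: integrable_abs integrable_mult_right integrable_norm)
      also have "\<dots> \<le> 2 * R * (1 + G0\<^sup>2 + G1 * F)"
        using est_norm[of "x j \<omega>"] rF[OF w, of j] R unfolding r_def by simp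
      finally show ?thesis .
    qed
    have i: "integrable M (\<lambda>\<omega>. h (\<xi> j \<omega>) (x j \<omega>, z j \<omega>))"
      using h_int by (intro integrable_sample_bounded(1)[OF h_m _ h_bd]) (auto simp: has_bochner_integral_iff)
    \<comment> \<open>This exchanges the stochastic gradient for the exact one. It also yields
      measurability of the inner product with \<open>grad\<close>, which is not assumed of
      \<open>grad\<close> itself: as a sample mean of \<open>h\<close> it is a parametrized
      integral.\<close>
    have h_mean: "(\<integral>s. h s y \<partial>D) = (snd y - xs) \<bullet> grad (fst y)" for y
      using h_int by (simp add: has_bochner_integral_iff)
    show ?thesis using integral_sample[OF h_m i] i unfolding h_mean by (simp add: h_def)
  qed

  \<comment> \<open>The roots of \<open>U\<close> and \<open>V\<close> are the Euclidean norms, over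
    the indices 1 to \<open>k\<close>, of the noise part and of the gaps; the latter bound the part
    \<open>v\<close> up to the factor \<open>G1\<close>.\<close>
  define U where "U \<omega> = (\<Sum>j=1..k. (norm (u (\<xi> j \<omega>) (x j \<omega>)))\<^sup>2)" for \<omega>
  define V where "V \<omega> = (\<Sum>j=1..k. (r j \<omega>)\<^sup>2)" for \<omega>
  have U: "integrable M (\<lambda>\<omega>. sqrt (U \<omega>))" "expectation (\<lambda>\<omega>. sqrt (U \<omega>)) \<le> sqrt (k * G0\<^sup>2)"
  proof -
    have "expectation U = (\<Sum>j=1..k. expectation (\<lambda>\<omega>. (norm (u (\<xi> j \<omega>) (x j \<omega>)))\<^sup>2))"
      unfolding U_def using u2 by (intro Bochner_Integration.integral_sum) auto
    also have "\<dots> \<le> (\<Sum>j=1..k. G0\<^sup>2)" using u2 by (intro sum_mono) auto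
    finally have b: "expectation U \<le> k * G0\<^sup>2" by simp
    have i: "integrable M U"
      unfolding U_def using u2 by (intro Bochner_Integration.integrable_sum) auto
    have n: "0 \<le> U \<omega>" for \<omega> unfolding U_def by (intro sum_nonneg) auto
    show "integrable M (\<lambda>\<omega>. sqrt (U \<omega>))" "expectation (\<lambda>\<omega>. sqrt (U \<omega>)) \<le> sqrt (k * G0\<^sup>2)"
      by (rule expectation_sqrt_le[OF i n b])+
  qed
  have V: "integrable M (\<lambda>\<omega>. sqrt (V \<omega>))"
    "expectation (\<lambda>\<omega>. sqrt (V \<omega>)) \<le> sqrt (F * (\<Sum>j=1..k. a j))"
  proof -
    have "expectation V = (\<Sum>j=1..k. expectation (\<lambda>\<omega>. (r j \<omega>)\<^sup>2))"
      unfolding V_def using r2_int by (intro Bochner_Integration.integral_sum) auto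
    also have "\<dots> \<le> (\<Sum>j=1..k. expectation (\<lambda>\<omega>. F * r j \<omega>))"
      using r2_int r_int rF r0
      by (intro sum_mono integral_mono) (auto simp: power2_eq_square intro!: mult_right_mono)
    also have "\<dots> = F * (\<Sum>j=1..k. a j)" by (simp add: a sum_distrib_left)
    finally have b: "expectation V \<le> F * (\<Sum>j=1..k. a j)" .
    have i: "integrable M V"
      unfolding V_def using r2_int by (intro Bochner_Integration.integrable_sum) auto
    have n: "0 \<le> V \<omega>" for \<omega> unfolding V_def by (intro sum_nonneg) auto
    show "integrable M (\<lambda>\<omega>. sqrt (V \<omega>))"
      "expectation (\<lambda>\<omega>. sqrt (V \<omega>)) \<le> sqrt (F * (\<Sum>j=1..k. a j))"
      by (rule expectation_sqrt_le[OF i n b])+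
  qed

  have "real k * a k = expectation (\<lambda>\<omega>. k * r k \<omega>)" by (simp add: a)
  also have "\<dots> \<le> expectation (\<lambda>\<omega>. \<Sum>j=1..k. (z j \<omega> - xs) \<bullet> grad (x j \<omega>))"
    using est r_int unfolding r_def x_def
    by (intro integral_mono anytime_online_to_batch grad) (auto intro!: Bochner_Integration.integrable_sum)
  also have "\<dots> = expectation (\<lambda>\<omega>. \<Sum>j=1..k. (z j \<omega> - xs) \<bullet> est (\<xi> j \<omega>) (x j \<omega>))"
    using est by (simp add: Bochner_Integration.integral_sum)
  also have "\<dots> \<le> expectation (\<lambda>\<omega>. C * R * (sqrt (U \<omega>) + G1 * sqrt (V \<omega>)))"
  proof (rule integral_mono_AE)
    show "integrable M (\<lambda>\<omega>. \<Sum>j=1..k. (z j \<omega> - xs) \<bullet> est (\<xi> j \<omega>) (x j \<omega>))"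
      using est by (intro Bochner_Integration.integrable_sum) auto
    show "integrable M (\<lambda>\<omega>. C * R * (sqrt (U \<omega>) + G1 * sqrt (V \<omega>)))"
      using U V by auto
    \<comment> \<open>Only finitely many indices are involved, so the null sets can be merged and
      the rest argued for a single outcome.\<close>
    have "AE \<omega> in M. \<forall>j\<in>{1..k}. norm (v (\<xi> j \<omega>) (x j \<omega>)) \<le> G1 * r j \<omega>"
      using v by (intro eventually_ball_finite) auto
    moreover have "AE \<omega> in M. regret R (\<lambda>j. z j \<omega>) (\<lambda>j. online_loss (\<lambda>k. 1 / real k) real est
        (\<lambda>i. \<xi> i \<omega>) (\<lambda>i. z i \<omega>) j) k \<le> C * R * sqrt (\<Sum>j=1..k. (norm (online_loss (\<lambda>k. 1 / real k) real est
        (\<lambda>i. \<xi> i \<omega>) (\<lambda>i. z i \<omega>) j))\<^sup>2)"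
      using reg k by (auto simp: regret_bound_def)
    ultimately show "AE \<omega> in M. (\<Sum>j=1..k. (z j \<omega> - xs) \<bullet> est (\<xi> j \<omega>) (x j \<omega>)) \<le>
        C * R * (sqrt (U \<omega>) + G1 * sqrt (V \<omega>))"
      using AE_space
    proof eventually_elim
      case (elim \<omega>)
      define g where "g = online_loss (\<lambda>k. 1 / real k) real est (\<lambda>i. \<xi> i \<omega>) (\<lambda>i. z i \<omega>)"
      \<comment> \<open>The step size \<open>1 / j\<close> and the weight \<open>j\<close> cancel
        for positive \<open>j\<close>, so the losses are unscaled stochastic gradients.\<close>
      have g: "g j = est (\<xi> j \<omega>) (x j \<omega>)" if "j \<in> {1..k}" for j
        using that by (simp add: g_def online_loss_def x_def)
      have "norm (g j) \<le> norm (u (\<xi> j \<omega>) (x j \<omega>)) + G1 * r j \<omega>" if j: "j \<in> {1..k}" for j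
      proof -
        have "\<xi> j \<in> measurable M D" using j scheme by (simp add: averaged_online_scheme_def)
        hence "\<xi> j \<omega> \<in> space D" using elim(3) by (rule measurable_space)
        hence "norm (g j) \<le> norm (u (\<xi> j \<omega>) (x j \<omega>)) + norm (v (\<xi> j \<omega>) (x j \<omega>))"
          by (simp add: g[OF j] est_eq norm_triangle_ineq)
        thus ?thesis using elim(1) j by fastforce
      qed
      hence "L2_set (\<lambda>j. norm (g j)) {1..k} \<le>
          L2_set (\<lambda>j. norm (u (\<xi> j \<omega>) (x j \<omega>)) + G1 * r j \<omega>) {1..k}"
        by (intro L2_set_mono) auto
      also have "\<dots> \<le> L2_set (\<lambda>j. norm (u (\<xi> j \<omega>) (x j \<omega>))) {1..k} + L2_set (\<lambda>j. G1 * r j \<omega>) {1..k}"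
        by (rule L2_set_triangle_ineq)
      also have "\<dots> = sqrt (U \<omega>) + G1 * sqrt (V \<omega>)"
        using L2_set_right_distrib[OF G(2), of "\<lambda>j. r j \<omega>" "{1..k}"]
        by (simp add: U_def V_def L2_set_def)
      finally have L: "sqrt (\<Sum>j=1..k. (norm (g j))\<^sup>2) \<le> sqrt (U \<omega>) + G1 * sqrt (V \<omega>)"
        by (simp add: L2_set_def)
      have "(\<Sum>j=1..k. (z j \<omega> - xs) \<bullet> est (\<xi> j \<omega>) (x j \<omega>)) = (\<Sum>j=1..k. (z j \<omega> - xs) \<bullet> g j)"
        using g by simp
      also have "\<dots> \<le> regret R (\<lambda>j. z j \<omega>) g k" by (rule le_regret[OF xs])
      also have "\<dots> \<le> C * R * sqrt (\<Sum>j=1..k. (norm (g j))\<^sup>2)"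
        using elim(2) unfolding g_def .
      also have "\<dots> \<le> C * R * (sqrt (U \<omega>) + G1 * sqrt (V \<omega>))"
        using L C R by (intro mult_left_mono) auto
      finally show ?case .
    qed
  qed
  also have "\<dots> = C * R * (expectation (\<lambda>\<omega>. sqrt (U \<omega>)) + G1 * expectation (\<lambda>\<omega>. sqrt (V \<omega>)))"
    using U V by simp
  also have "\<dots> \<le> C * R * (sqrt (k * G0\<^sup>2) + G1 * sqrt (F * (\<Sum>j=1..k. a j)))"
    using U V C R G by (intro mult_left_mono add_mono) auto
  finally show ?thesis
    using G unfolding F_def[symmetric] by (simp add: real_sqrt_mult algebra_simps)
qed

section \<open>Matching the recursion with the prescribed number of iterations\<close>

theorem theorem5:
  fixes C :: real
  assumes "C \<ge> 1"
  shows "\<exists>C'>0. C' \<le> const_cap C \<and>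
    (\<forall>(f :: real ^ 'n \<Rightarrow> real) xstar R G0 G1 (D :: 's measure) grad est
       (M :: 'w measure) (alg :: 'r \<Rightarrow> (real ^ 'n) list \<Rightarrow> real ^ 'n) seed \<xi> z \<epsilon> (K :: nat).
       convex_on UNIV f \<longrightarrow>
       (\<forall>y. f xstar \<le> f y) \<longrightarrow>
       norm xstar \<le> R \<longrightarrow>
       R > 0 \<longrightarrow>
       stoch_gen_lipschitz D f (f xstar) grad est G0 G1 \<longrightarrow>
       R * G1 \<ge> 1 \<longrightarrow>
       averaged_online_scheme M D R (\<lambda>k. 1 / real k) (\<lambda>k. real k) est alg seed \<xi> z \<longrightarrow>
       regret_bound M C R z
         (\<lambda>k \<omega>. online_loss (\<lambda>k. 1 / real k) (\<lambda>k. real k) est (\<lambda>i. \<xi> i \<omega>) (\<lambda>i. z i \<omega>) k) \<longrightarrow>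
       \<epsilon> > 0 \<longrightarrow>
       int K = \<lceil>(R * G0 / \<epsilon>)\<^sup>2 + (R * G1)\<^sup>2 * (max_gap f (f xstar) R / \<epsilon>) *
                 ln (exp 1 + R * G0 / \<epsilon> + (R * G1)\<^sup>2 * (max_gap f (f xstar) R / \<epsilon>))\<rceil> \<longrightarrow>
       prob_space.expectation M
         (\<lambda>\<omega>. f (avg_iter (\<lambda>k. 1 / real k) (\<lambda>i. z i \<omega>) K) - f xstar) \<le> C' * \<epsilon>)"
proof -
  have "prob_space.expectation M
         (\<lambda>\<omega>. f (avg_iter (\<lambda>k. 1 / real k) (\<lambda>i. z i \<omega>) K) - f xstar) \<le> 6 * C\<^sup>2 * \<epsilon>"
    if conv: "convex_on UNIV f" and min: "\<forall>y. f xstar \<le> f y" and xs: "norm xstar \<le> R" and R: "R > 0"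
      and lip: "stoch_gen_lipschitz D f (f xstar) grad est G0 G1" and RG: "R * G1 \<ge> 1"
      and scheme: "averaged_online_scheme M D R (\<lambda>k. 1 / real k) (\<lambda>k. real k) est alg seed \<xi> z"
      and reg: "regret_bound M C R z
         (\<lambda>k \<omega>. online_loss (\<lambda>k. 1 / real k) (\<lambda>k. real k) est (\<lambda>i. \<xi> i \<omega>) (\<lambda>i. z i \<omega>) k)"
      and \<epsilon>: "\<epsilon> > 0"
      and K: "int K = \<lceil>(R * G0 / \<epsilon>)\<^sup>2 + (R * G1)\<^sup>2 * (max_gap f (f xstar) R / \<epsilon>) *
                 ln (exp 1 + R * G0 / \<epsilon> + (R * G1)\<^sup>2 * (max_gap f (f xstar) R / \<epsilon>))\<rceil>"
    for f :: "real ^ 'n \<Rightarrow> real" and xstar R G0 G1 and D :: "'s measure" and grad est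
       and M :: "'w measure" and alg :: "'r \<Rightarrow> (real ^ 'n) list \<Rightarrow> real ^ 'n" and seed \<xi> z \<epsilon> and K :: nat
  proof -
    interpret prob_space M using scheme by (simp add: averaged_online_scheme_def)
    define F where "F = max_gap f (f xstar) R"
    define A where "A = R * G0 / \<epsilon>"
    define B where "B = (R * G1)\<^sup>2 * (F / \<epsilon>)"
    define T where "T = A\<^sup>2 + B * ln (exp 1 + A + B)"
    define a where "a k = expectation (\<lambda>\<omega>. f (avg_iter (\<lambda>k. 1 / real k) (\<lambda>i. z i \<omega>) k) - f xstar)" for k
    have cont: "continuous_on UNIV f" using conv by (intro convex_on_continuous) auto
    have F0: "0 \<le> F" using le_max_gap[OF cont xs, of "f xstar"] by (simp add: F_def)
    have G: "0 \<le> G0" "0 \<le> G1" using lip by (auto simp: stoch_gen_lipschitz_def)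
    have AB: "0 \<le> A" "0 \<le> B" unfolding A_def B_def using R G F0 \<epsilon> by auto
    have KT: "int K = \<lceil>T\<rceil>" using K unfolding T_def A_def B_def F_def .
    hence low: "T \<le> real K" and up: "real K \<le> T + 1" by linarith+
    have "ln (exp 1) \<le> ln (exp 1 + A + B)"
      using AB by (intro ln_mono) (auto simp: add.assoc)
    hence L: "1 \<le> ln (exp 1 + A + B)" by simp
    have "a K \<le> 6 * C\<^sup>2 * \<epsilon>"
    proof (cases "K = 0")
      \<comment> \<open>With no iterations the output is the origin. A ceiling of 0 forces
        \<open>B \<le> 0\<close>, and \<open>R * G1 \<ge> 1\<close> turns this into
        \<open>F \<le> 0\<close>, so the origin is already a minimizer.\<close>
      case True
      have "B * 1 \<le> B * ln (exp 1 + A + B)" using L AB by (intro mult_left_mono) auto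
      moreover have "T \<le> 0" using low True by simp
      ultimately have "B \<le> 0" unfolding T_def using zero_le_power2[of A] by linarith
      hence "F \<le> 0" unfolding B_def using RG \<epsilon> by (auto simp: mult_le_0_iff divide_le_0_iff)
      moreover have "f 0 - f xstar \<le> F"
        unfolding F_def using R by (intro le_max_gap[OF cont]) auto
      moreover have "a K = f 0 - f xstar" by (simp add: a_def True prob_space)
      moreover have "0 \<le> 6 * C\<^sup>2 * \<epsilon>" using \<epsilon> by simp
      ultimately show ?thesis by linarith
    next
      case False
      \<comment> \<open>These are the coefficients of \<open>expected_gap_recursion\<close>. In
        terms of the quantities in the formula for \<open>K\<close> they read
        \<open>c = C * A * \<epsilon>\<close> and
        \<open>b\<^sup>2 = C\<^sup>2 * B * \<epsilon>\<close>.\<close>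
      define b where "b = C * R * G1 * sqrt F"
      define c where "c = C * R * G0"
      have "a K \<le> c / sqrt K + b\<^sup>2 * harm K / K + b * sqrt (2 * c * sqrt K) / K"
      proof (rule averaged_recursion_bound)
        show "0 \<le> b" "0 \<le> c" unfolding b_def c_def using assms R G F0 by auto
        show "0 \<le> a k" for k unfolding a_def using min by (intro integral_nonneg_AE) auto
        show "k * a k \<le> c * sqrt k + b * sqrt (\<Sum>j=1..k. a j)" if "1 \<le> k" for k
          unfolding a_def b_def c_def F_def using assms min that
          by (intro expected_gap_recursion[OF cont _ xs R _ lip scheme reg]) auto
      qed (use False in simp)
      also have "\<dots> \<le> 6 * C\<^sup>2 * \<epsilon>"
      proof (rule iteration_count_bound[OF AB assms \<epsilon>])
        show "c = C * A * \<epsilon>" using \<epsilon> by (simp add: c_def A_def)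
        show "0 \<le> b" unfolding b_def using assms R G F0 by auto
        show "b\<^sup>2 = C\<^sup>2 * B * \<epsilon>" using \<epsilon> F0 by (simp add: b_def B_def power_mult_distrib)
      qed (use False low up in \<open>auto simp: T_def\<close>)
      finally show ?thesis .
    qed
    thus ?thesis unfolding a_def .
  qed
  \<comment> \<open>The witness is the 6 of \<open>iteration_count_bound\<close>, which lies below
    the cap with room to spare.\<close>
  moreover have "0 < 6 * C\<^sup>2" "6 * C\<^sup>2 \<le> const_cap C" using assms by (auto simp: const_cap_def)
  ultimately show ?thesis by (intro exI[of _ "6 * C\<^sup>2"]) blast
qed

end
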